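(* Let $d\ge 1$, let $\Gamma\subset\mathbb{R}^d$ be a countable set, and let $r>0$ be such that every point of $\mathbb{R}^d$ is within $\|\cdot\|_\infty$-distance at most $r$ of some point of $\Gamma$. Let $\mathcal{H}\neq\{0\}$ be a separable Hilbert space and let $H$ be a bounded self-adjoint operator on $\ell^2(\Gamma;\mathcal{H})$ with finite range hoppings of maximal hopping length $m$, i.e. $H_{xy}=0$ for all $x,y\in\Gamma$ with $\|x-y\|_\infty>m$. Let $L>0$, $N\in\mathbb{N}$ with $N\ge 2$, $l:=\frac{L+r}{N}+r$, and $\lambda\in\mathbb{R}$. Assume that for every $x\in\Gamma$ there exists a set $A(x)\subset\Gamma$ such that $\overline{B_l}(x)\cap\Gamma\subseteq A(x)\subseteq B_{L-m}(x)$, $\lambda\notin\sigma(H_{A(x)})$, and $$D(x):=\left\|\mathbf{1}_{\overline{B_l}(x)}\,(H_{A(x)}-\lambda)^{-1}\,\mathbf{1}_{A(x)}\,H\,\mathbf{1}_{B_L(x)\setminus A(x)}\right\|_{\mathrm{op}}$$ satisfies $D(x)<N^{-d/2}$. Then $H$ is $\epsilon$-bulk-gapped at energy $\lambda$ and scale $L$ (with respect to $r$) for every $\epsilon>0$ with $$\epsilon<\inf_{x\in\Gamma}\frac{N^{-d/2}-D(x)}{\left\|\mathbf{1}_{\overline{B_l}(x)}\,(H_{A(x)}-\lambda)^{-1}\,\mathbf{1}_{A(x)}\right\|_{\mathrm{op}}} .$$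
   Context: Distances in $\mathbb{R}^d$ are measured with $\|x\|_\infty=\max\{|x_1|,\dots,|x_d|\}$. For $x\in\mathbb{R}^d$, $B_\rho(x)=\prod_{j=1}^d(x_j-\rho,x_j+\rho)$ is the open cube of side length $2\rho$ centered at $x$ (empty if $\rho\le 0$), and $\overline{B_\rho}(x)$ (for $\rho>0$) is its closure. For $A\subset\mathbb{R}^d$ and $\psi\in\ell^2(\Gamma;\mathcal{H})$, $\|\psi\|_A^2:=\sum_{x\in\Gamma\cap A}\|\psi(x)\|_{\mathcal{H}}^2$. The bounded operators $H_{xy}$ on $\mathcal{H}$ ($x,y\in\Gamma$) are the matrix elements of $H$, i.e. $H_{xy}v=(H(\delta_y\otimes v))(x)$, where $\delta_y\otimes v$ is the function equal to $v$ at $y$ and $0$ elsewhere. For $A\subset\mathbb{R}^d$, $\mathbf{1}_A$ denotes multiplication by the characteristic function of $A$ on $\ell^2(\Gamma;\mathcal{H})$, and $H_A:=\mathbf{1}_A H\mathbf{1}_A$, regarded as an operator on the subspace $\ell^2(\Gamma\cap A;\mathcal{H})=\operatorname{ran}\mathbf{1}_A$; $\sigma(H_A)$ and $(H_A-\lambda)^{-1}$ refer to this operator on $\ell^2(\Gamma\cap A;\mathcal{H})$. $\|\cdot\|_{\mathrm{op}}$ is the operator norm. Definition. Let $\epsilon,L>0$ and $\lambda\in\mathbb{R}$. The operator $H$ is called $\epsilon$-bulk-gapped at energy $\lambda$ and scale $L$ if there exist constants $N\in\mathbb{N}$ with $N\ge 2$ and $C<1/N^d$ such that, with $l:=\frac{L+r}{N}+r$,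 the following implication holds for every $x\in\Gamma$ and every $\psi\in\ell^2(\Gamma;\mathcal{H})$: whenever $$\|(H-\lambda)\psi\|_{B_L(x)}\le\epsilon\,\|\psi\|_{B_L(x)},$$ then $$\|\psi\|_{\overline{B_l}(x)}^2\le C\,\|\psi\|_{B_L(x)}^2 .$$ *)

theory Defs
  imports "HOL-Analysis.Analysis"
begin

text \<open>Complex Hilbert spaces. Inner products are conjugate-linear in the first argument.\<close>

class complex_inner = real_normed_vector +
  fixes scaleC :: "complex \<Rightarrow> 'a \<Rightarrow> 'a" (infixr "*\<^sub>C" 75)
    and cinner :: "'a \<Rightarrow> 'a \<Rightarrow> complex"
  assumes scaleC_add_right: "a *\<^sub>C (x + y) = a *\<^sub>C x + a *\<^sub>C y"
    and scaleC_add_left: "(a + b) *\<^sub>C x = a *\<^sub>C x + b *\<^sub>C x"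
    and scaleC_scaleC: "a *\<^sub>C b *\<^sub>C x = (a * b) *\<^sub>C x"
    and scaleC_of_real: "complex_of_real s *\<^sub>C x = s *\<^sub>R x"
    and cinner_commute: "cinner x y = cnj (cinner y x)"
    and cinner_add_left: "cinner (x + y) z = cinner x z + cinner y z"
    and cinner_scaleC_left: "cinner (a *\<^sub>C x) y = cnj a * cinner x y"
    and cinner_self: "cinner x x = complex_of_real ((norm x)\<^sup>2)"

class complex_hilbert = complex_inner + complete_space

instantiation complex :: complex_hilbert
begin

definition scaleC_complex :: "complex \<Rightarrow> complex \<Rightarrow> complex" where
  "scaleC_complex a x = a * x"

definition cinner_complex :: "complex \<Rightarrow> complex \<Rightarrow> complex" where
  "cinner_complex x y = cnj x * y"

instance
  by standard
    (simp_all add: scaleC_complex_def cinner_complex_def algebra_simps scaleR_conv_of_real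
      complex_norm_square[symmetric] del: of_real_power)

end

text \<open>Elements of \<open>\<ell>\<^sup>2(S; \<H>)\<close> are functions on the whole index type that vanish off \<open>S\<close>.
  Thus \<open>\<ell>\<^sup>2(S \<inter> A; \<H>)\<close> is literally a subspace of \<open>\<ell>\<^sup>2(S; \<H>)\<close>, namely the range of the
  multiplication by the characteristic function of \<open>A\<close>.\<close>

definition ell2 :: "'i set \<Rightarrow> ('i \<Rightarrow> 'h::real_normed_vector) set" where
  "ell2 S = {\<psi>. (\<forall>x. x \<notin> S \<longrightarrow> \<psi> x = 0) \<and> (\<lambda>x. (norm (\<psi> x))\<^sup>2) summable_on S}"

definition l2norm :: "'i set \<Rightarrow> ('i \<Rightarrow> 'h::real_normed_vector) \<Rightarrow> real" where
  "l2norm S \<psi> = sqrt (\<Sum>\<^sub>\<infinity>x\<in>S. (norm (\<psi> x))\<^sup>2)"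

definition l2inner :: "'i set \<Rightarrow> ('i \<Rightarrow> 'h::complex_inner) \<Rightarrow> ('i \<Rightarrow> 'h) \<Rightarrow> complex" where
  "l2inner S \<phi> \<psi> = (\<Sum>\<^sub>\<infinity>x\<in>S. cinner (\<phi> x) (\<psi> x))"

definition restr :: "'i set \<Rightarrow> ('i \<Rightarrow> 'h) \<Rightarrow> 'i \<Rightarrow> 'h::zero" where
  "restr A \<psi> = (\<lambda>x. if x \<in> A then \<psi> x else 0)"

text \<open>An operator on \<open>\<ell>\<^sup>2(S; \<H>)\<close> is a HOL function of which only the values on \<open>ell2 S\<close> matter.\<close>

definition bounded_op :: "'i set \<Rightarrow> (('i \<Rightarrow> 'h) \<Rightarrow> ('i \<Rightarrow> 'h::complex_inner)) \<Rightarrow> bool" where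
  "bounded_op S T \<longleftrightarrow>
     (\<forall>\<psi>\<in>ell2 S. T \<psi> \<in> ell2 S) \<and>
     (\<forall>\<phi>\<in>ell2 S. \<forall>\<psi>\<in>ell2 S. T (\<lambda>x. \<phi> x + \<psi> x) = (\<lambda>x. T \<phi> x + T \<psi> x)) \<and>
     (\<forall>a. \<forall>\<psi>\<in>ell2 S. T (\<lambda>x. a *\<^sub>C \<psi> x) = (\<lambda>x. a *\<^sub>C T \<psi> x)) \<and>
     (\<exists>K. \<forall>\<psi>\<in>ell2 S. l2norm S (T \<psi>) \<le> K * l2norm S \<psi>)"

definition selfadjoint_op :: "'i set \<Rightarrow> (('i \<Rightarrow> 'h) \<Rightarrow> ('i \<Rightarrow> 'h::complex_inner)) \<Rightarrow> bool" where
  "selfadjoint_op S T \<longleftrightarrow>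
     (\<forall>\<phi>\<in>ell2 S. \<forall>\<psi>\<in>ell2 S. l2inner S (T \<phi>) \<psi> = l2inner S \<phi> (T \<psi>))"

definition op_norm :: "'i set \<Rightarrow> (('i \<Rightarrow> 'h) \<Rightarrow> ('i \<Rightarrow> 'h::complex_inner)) \<Rightarrow> real" where
  "op_norm S T = Sup {l2norm S (T \<psi>) | \<psi>. \<psi> \<in> ell2 S \<and> l2norm S \<psi> \<le> 1}"

definition shifted ::
    "(('i \<Rightarrow> 'h) \<Rightarrow> ('i \<Rightarrow> 'h)) \<Rightarrow> complex \<Rightarrow> ('i \<Rightarrow> 'h) \<Rightarrow> 'i \<Rightarrow> 'h::complex_inner" where
  "shifted T z \<psi> = (\<lambda>x. T \<psi> x - z *\<^sub>C \<psi> x)"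

definition op_spectrum ::
    "'i set \<Rightarrow> (('i \<Rightarrow> 'h) \<Rightarrow> ('i \<Rightarrow> 'h::complex_inner)) \<Rightarrow> complex set" where
  "op_spectrum S T = {z. \<not> (\<exists>R. bounded_op S R \<and>
     (\<forall>\<psi>\<in>ell2 S. R (shifted T z \<psi>) = \<psi> \<and> shifted T z (R \<psi>) = \<psi>))}"

text \<open>This is the inverse of \<open>T - z\<close> on \<open>\<ell>\<^sup>2(S; \<H>)\<close> only if \<open>z\<close> is not in the spectrum.\<close>

definition resolvent ::
    "'i set \<Rightarrow> (('i \<Rightarrow> 'h) \<Rightarrow> ('i \<Rightarrow> 'h)) \<Rightarrow> complex \<Rightarrow> ('i \<Rightarrow> 'h) \<Rightarrow> 'i \<Rightarrow> 'h::complex_inner" where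
  "resolvent S T z = inv_into (ell2 S) (shifted T z)"

definition compression ::
    "'i set \<Rightarrow> (('i \<Rightarrow> 'h) \<Rightarrow> ('i \<Rightarrow> 'h)) \<Rightarrow> ('i \<Rightarrow> 'h) \<Rightarrow> 'i \<Rightarrow> 'h::zero" where
  "compression A H = restr A \<circ> H \<circ> restr A"

definition matrix_element ::
    "(('i \<Rightarrow> 'h) \<Rightarrow> ('i \<Rightarrow> 'h)) \<Rightarrow> 'i \<Rightarrow> 'i \<Rightarrow> 'h \<Rightarrow> 'h::zero" where
  "matrix_element H x y v = H (\<lambda>z. if z = y then v else 0) x"

definition finite_range ::
    "(real^'d) set \<Rightarrow> real \<Rightarrow> ((real^'d \<Rightarrow> 'h) \<Rightarrow> (real^'d \<Rightarrow> 'h::zero)) \<Rightarrow> bool" where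
  "finite_range \<Gamma> m H \<longleftrightarrow>
     (\<forall>x\<in>\<Gamma>. \<forall>y\<in>\<Gamma>. infnorm (x - y) > m \<longrightarrow> matrix_element H x y = (\<lambda>v. 0))"

definition cube :: "real \<Rightarrow> real^'d \<Rightarrow> (real^'d) set" where
  "cube \<rho> x = {y. \<forall>j. x $ j - \<rho> < y $ j \<and> y $ j < x $ j + \<rho>}"

text \<open>The context of this notion supplies \<open>\<epsilon> > 0\<close>, \<open>L > 0\<close> and \<open>r > 0\<close>.\<close>

definition bulk_gapped ::
    "(real^'d) set \<Rightarrow> real \<Rightarrow> ((real^'d \<Rightarrow> 'h) \<Rightarrow> (real^'d \<Rightarrow> 'h::complex_inner)) \<Rightarrow>
      real \<Rightarrow> real \<Rightarrow> real \<Rightarrow> bool" where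
  "bulk_gapped \<Gamma> r H \<epsilon> lam L \<longleftrightarrow>
     (\<exists>(N::nat) (C::real). N \<ge> 2 \<and> C < 1 / real N ^ CARD('d) \<and>
       (let l = (L + r) / real N + r in
        \<forall>x\<in>\<Gamma>. \<forall>\<psi>\<in>ell2 \<Gamma>.
          l2norm (\<Gamma> \<inter> cube L x) (shifted H (complex_of_real lam) \<psi>)
            \<le> \<epsilon> * l2norm (\<Gamma> \<inter> cube L x) \<psi> \<longrightarrow>
          (l2norm (\<Gamma> \<inter> closure (cube l x)) \<psi>)\<^sup>2 \<le> C * (l2norm (\<Gamma> \<inter> cube L x) \<psi>)\<^sup>2))"

end

theory Submission
  imports Defs
begin

text \<open>Write \<open>B\<close> for the cube of radius \<open>L\<close>, \<open>Q\<close> for the closed cube of radius \<open>l\<close> and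
  \<open>P = 1\<^sub>Q (H\<^sub>A - \<lambda>)\<inverse> 1\<^sub>A\<close>. Since \<open>A\<close> keeps distance \<open>m\<close> from the complement of \<open>B\<close>,
  \<open>1\<^sub>A (H - \<lambda>) \<psi> = (H\<^sub>A - \<lambda>) 1\<^sub>A \<psi> + 1\<^sub>A H 1\<^bsub>B - A\<^esub> \<psi>\<close>. Applying \<open>P\<close> yields
  \<open>\<parallel>\<psi>\<parallel>\<^sub>Q \<le> G \<parallel>(H - \<lambda>) \<psi>\<parallel>\<^sub>B + D \<parallel>\<psi>\<parallel>\<^sub>B \<le> (G \<epsilon> + D) \<parallel>\<psi>\<parallel>\<^sub>B\<close>. The factor is bounded away from
  \<open>N\<^bsup>-d/2\<^esup>\<close> uniformly in the centre because \<open>G\<close> is bounded below by \<open>1 / (\<parallel>H\<parallel> + \<bar>\<lambda>\<bar>)\<close>.\<close>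

section \<open>Complex scalars and the norm\<close>

text \<open>For nonreal \<open>a\<close> the class axioms reach the norm only through
  \<open>cinner_self\<close>; pulling \<open>a\<close> out of both slots of \<open>cinner\<close>
  gives \<open>cnj a * a\<close>, the squared modulus.\<close>

lemma norm_scaleC: "norm (a *\<^sub>C x) = cmod a * norm (x::'h::complex_inner)"
proof -
  have "cinner (a *\<^sub>C x) (a *\<^sub>C x) = cnj a * cnj (cinner (a *\<^sub>C x) x)"
    by (metis cinner_commute cinner_scaleC_left)
  also have "\<dots> = cnj a * a * cinner x x"
    by (simp add: cinner_scaleC_left cinner_self)
  finally have "complex_of_real ((norm (a *\<^sub>C x))\<^sup>2) = complex_of_real ((cmod a)\<^sup>2 * (norm x)\<^sup>2)"
    unfolding cinner_self
    by (simp add: complex_norm_square mult.commute del: of_real_power)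
  then have "(norm (a *\<^sub>C x))\<^sup>2 = (cmod a * norm x)\<^sup>2"
    unfolding of_real_eq_iff by (simp add: power_mult_distrib)
  then show ?thesis
    by (simp add: power2_eq_iff_nonneg)
qed

lemma scaleC_zero_right [simp]: "a *\<^sub>C (0::'h::complex_inner) = 0"
  using norm_scaleC[of a "0::'h"] by simp

lemma scaleC_minus_one: "(-1) *\<^sub>C x = - (x::'h::complex_inner)"
  using scaleC_of_real[of "-1" x] by simp

section \<open>Square-summable functions\<close>

lemma l2norm_nonneg [simp]: "0 \<le> l2norm S \<psi>"
  unfolding l2norm_def by (simp add: infsum_nonneg)

lemma ell2_off: "\<psi> \<in> ell2 S \<Longrightarrow> x \<notin> S \<Longrightarrow> \<psi> x = 0"
  unfolding ell2_def by blast

lemma L2_set_le_l2norm: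
  assumes "\<psi> \<in> ell2 S" "finite F" "F \<subseteq> S"
  shows "L2_set (\<lambda>x. norm (\<psi> x)) F \<le> l2norm S \<psi>"
  unfolding L2_set_def l2norm_def real_sqrt_le_iff
  using assms by (intro finite_sum_le_infsum) (auto simp: ell2_def)

text \<open>Nonnegative terms with bounded finite sums are summable, and the total obeys the same
  bound. Inequalities for \<open>L2_set\<close> thus carry over to \<open>ell2\<close>.\<close>

lemma ell2I_L2_set:
  assumes off: "\<And>x. x \<notin> S \<Longrightarrow> \<psi> x = 0"
    and bound: "\<And>F. finite F \<Longrightarrow> F \<subseteq> S \<Longrightarrow> L2_set (\<lambda>x. norm (\<psi> x)) F \<le> K"
  shows "\<psi> \<in> ell2 S" and "l2norm S \<psi> \<le> K"
proof -
  \<comment> \<open>The empty subset forces \<open>K\<close> to be nonnegative, which allows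
    squaring the bound and taking the root again.\<close>
  have K: "0 \<le> K"
    using bound[of "{}"] by simp
  have sq: "(\<Sum>x\<in>F. (norm (\<psi> x))\<^sup>2) \<le> K\<^sup>2" if "finite F" "F \<subseteq> S" for F
    using bound[OF that] K unfolding L2_set_def
    by (metis real_sqrt_le_iff real_sqrt_unique)
  then have "(\<lambda>x. (norm (\<psi> x))\<^sup>2) summable_on S"
    by (intro nonneg_bdd_above_summable_on) (auto intro!: bdd_aboveI)
  then show "\<psi> \<in> ell2 S"
    using off by (simp add: ell2_def)
  have "(\<Sum>\<^sub>\<infinity>x\<in>S. (norm (\<psi> x))\<^sup>2) \<le> K\<^sup>2"
    by (intro infsum_le_finite_sums) (use \<open>_ summable_on S\<close> sq in auto)
  then show "l2norm S \<psi> \<le> K"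
    unfolding l2norm_def using K by (metis real_sqrt_le_iff real_sqrt_unique)
qed

lemma norm_le_l2norm:
  assumes "\<psi> \<in> ell2 S"
  shows "norm (\<psi> x) \<le> l2norm S \<psi>"
proof (cases "x \<in> S")
  case True
  then show ?thesis
    using L2_set_le_l2norm[OF assms, of "{x}"] by simp
qed (simp add: ell2_off[OF assms])

text \<open>Minkowski's inequality, inherited from \<open>L2_set_triangle_ineq\<close> on finite
  sets.\<close>

lemma
  assumes "\<phi> \<in> ell2 S" "\<psi> \<in> ell2 S"
  shows ell2_add: "(\<lambda>x. \<phi> x + \<psi> x) \<in> ell2 S"
    and l2norm_add: "l2norm S (\<lambda>x. \<phi> x + \<psi> x) \<le> l2norm S \<phi> + l2norm S \<psi>"
proof -
  have "L2_set (\<lambda>x. norm (\<phi> x + \<psi> x)) F \<le> l2norm S \<phi> + l2norm S \<psi>"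
    if "finite F" "F \<subseteq> S" for F
  proof -
    have "L2_set (\<lambda>x. norm (\<phi> x + \<psi> x)) F \<le> L2_set (\<lambda>x. norm (\<phi> x) + norm (\<psi> x)) F"
      by (intro L2_set_mono) (auto intro: norm_triangle_ineq)
    also have "\<dots> \<le> L2_set (\<lambda>x. norm (\<phi> x)) F + L2_set (\<lambda>x. norm (\<psi> x)) F"
      by (rule L2_set_triangle_ineq)
    finally show ?thesis
      using L2_set_le_l2norm[OF assms(1) that] L2_set_le_l2norm[OF assms(2) that] by linarith
  qed
  with ell2I_L2_set[of S "\<lambda>x. \<phi> x + \<psi> x"] ell2_off[OF assms(1)] ell2_off[OF assms(2)]
  show "(\<lambda>x. \<phi> x + \<psi> x) \<in> ell2 S"
    and "l2norm S (\<lambda>x. \<phi> x + \<psi> x) \<le> l2norm S \<phi> + l2norm S \<psi>"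
    by auto
qed

lemma l2norm_scaleC:
  "l2norm S (\<lambda>x. a *\<^sub>C \<psi> x) = cmod a * l2norm S (\<psi> :: 'i \<Rightarrow> 'h::complex_inner)"
proof -
  have "(\<Sum>\<^sub>\<infinity>x\<in>S. (norm (a *\<^sub>C \<psi> x))\<^sup>2) = (cmod a)\<^sup>2 * (\<Sum>\<^sub>\<infinity>x\<in>S. (norm (\<psi> x))\<^sup>2)"
    by (simp add: norm_scaleC power_mult_distrib infsum_cmult_right')
  then show ?thesis
    by (simp add: l2norm_def real_sqrt_mult)
qed

lemma ell2_scaleC:
  "\<psi> \<in> ell2 S \<Longrightarrow> (\<lambda>x. a *\<^sub>C \<psi> x :: 'h::complex_inner) \<in> ell2 S"
  unfolding ell2_def
  by (auto simp: norm_scaleC power_mult_distrib intro: summable_on_cmult_right)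

lemma
  assumes "\<phi> \<in> ell2 S" "\<psi> \<in> ell2 S"
  shows ell2_diff: "(\<lambda>x. \<phi> x - \<psi> x :: 'h::complex_inner) \<in> ell2 S"
    and l2norm_diff: "l2norm S (\<lambda>x. \<phi> x - \<psi> x) \<le> l2norm S \<phi> + l2norm S \<psi>"
  using ell2_add[OF assms(1) ell2_scaleC[OF assms(2), of "-1"]]
    l2norm_add[OF assms(1) ell2_scaleC[OF assms(2), of "-1"]] l2norm_scaleC[of S "-1" \<psi>]
  by (simp_all add: scaleC_minus_one)

lemma l2norm_restr: "l2norm S (restr B \<psi>) = l2norm (S \<inter> B) \<psi>"
  unfolding l2norm_def restr_def
  by (intro arg_cong[where f = sqrt] infsum_cong_neutral) auto

lemma ell2_restr_Int:
  assumes "\<psi> \<in> ell2 S"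
  shows "restr B \<psi> \<in> ell2 (S \<inter> B)"
proof -
  have "(\<lambda>x. (norm (\<psi> x))\<^sup>2) summable_on S \<inter> B"
    by (rule summable_on_subset_banach[of _ S]) (use assms in \<open>auto simp: ell2_def\<close>)
  then have "(\<lambda>x. (norm (restr B \<psi> x))\<^sup>2) summable_on S \<inter> B"
    by (rule summable_on_cong[THEN iffD1, rotated]) (simp add: restr_def)
  then show ?thesis
    using ell2_off[OF assms] by (auto simp: ell2_def restr_def)
qed

text \<open>Off \<open>T\<close> the function vanishes, so enlarging the index set adds only zero
  terms.\<close>

lemma ell2_mono:
  assumes "\<psi> \<in> ell2 T" "T \<subseteq> S"
  shows "\<psi> \<in> ell2 S"
proof -
  have "(\<lambda>x. (norm (\<psi> x))\<^sup>2) summable_on S \<longleftrightarrow> (\<lambda>x. (norm (\<psi> x))\<^sup>2) summable_on T"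
    by (rule summable_on_cong_neutral) (use assms ell2_off in auto)
  then show ?thesis
    using assms by (auto simp: ell2_def)
qed

lemma ell2_restr: "\<psi> \<in> ell2 S \<Longrightarrow> restr B \<psi> \<in> ell2 S"
  by (rule ell2_mono[OF ell2_restr_Int]) auto

lemma l2norm_supp:
  assumes "\<psi> \<in> ell2 T" "T \<subseteq> S"
  shows "l2norm S \<psi> = l2norm T \<psi>"
  unfolding l2norm_def
  by (intro arg_cong[where f = sqrt] infsum_cong_neutral) (use assms ell2_off in auto)

lemma l2norm_mono_set:
  assumes "\<psi> \<in> ell2 S" "A \<subseteq> B" "B \<subseteq> S"
  shows "l2norm A \<psi> \<le> l2norm B \<psi>"
  unfolding l2norm_def real_sqrt_le_iff
  by (intro infsum_mono_neutral)
    (use assms in \<open>auto simp: ell2_def intro: summable_on_subset_banach\<close>)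

lemma l2norm_restr_le:
  assumes "\<psi> \<in> ell2 S"
  shows "l2norm S (restr B \<psi>) \<le> l2norm S \<psi>"
  unfolding l2norm_restr by (rule l2norm_mono_set[OF assms]) auto

lemma ell2_single:
  assumes "y \<in> S"
  shows "(\<lambda>z. if z = y then v else 0) \<in> ell2 S"
proof -
  have "(\<lambda>x. (norm (if x = y then v else 0))\<^sup>2) summable_on S
      \<longleftrightarrow> (\<lambda>x. (norm (if x = y then v else 0))\<^sup>2) summable_on {y}"
    by (rule summable_on_cong_neutral) (use assms in auto)
  then show ?thesis
    using assms by (auto simp: ell2_def)
qed

text \<open>A finite set that almost exhausts the square sum leaves a small remainder. This is the
  density of finitely supported functions, as needed for \<open>bounded_op_local\<close>.\<close>

lemma ell2_tail_small:
  assumes \<psi>: "\<psi> \<in> ell2 S" and "e > 0"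
  obtains F where "finite F" "F \<subseteq> S" "l2norm S (restr (- F) \<psi>) \<le> e"
proof -
  let ?f = "\<lambda>x. (norm (\<psi> x))\<^sup>2"
  have f: "?f summable_on S"
    using \<psi> by (simp add: ell2_def)
  \<comment> \<open>The tolerance is squared because the sum of squares is approximated, while
    \<open>l2norm\<close> is its root.\<close>
  obtain F where F: "finite F" "F \<subseteq> S" "dist (sum ?f F) (infsum ?f S) \<le> e\<^sup>2"
    using infsum_finite_approximation[OF f, of "e\<^sup>2"] \<open>e > 0\<close> by auto
  have "infsum ?f (S - F) = infsum ?f S - infsum ?f F"
    using F f by (intro infsum_Diff) auto
  also have "\<dots> \<le> e\<^sup>2"
    using F by (simp add: dist_real_def)
  finally have "l2norm (S - F) \<psi> \<le> e"
    unfolding l2norm_def using \<open>e > 0\<close> by (metis less_imp_le real_sqrt_le_iff real_sqrt_unique)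
  then show thesis
    using that F by (metis Diff_eq l2norm_restr)
qed

section \<open>Bounded operators\<close>

lemma bounded_opD:
  assumes "bounded_op S T"
  shows bounded_op_ell2: "\<psi> \<in> ell2 S \<Longrightarrow> T \<psi> \<in> ell2 S"
    and bounded_op_add: "\<phi> \<in> ell2 S \<Longrightarrow> \<psi> \<in> ell2 S \<Longrightarrow> T (\<lambda>x. \<phi> x + \<psi> x) = (\<lambda>x. T \<phi> x + T \<psi> x)"
    and bounded_op_scaleC: "\<psi> \<in> ell2 S \<Longrightarrow> T (\<lambda>x. a *\<^sub>C \<psi> x) = (\<lambda>x. a *\<^sub>C T \<psi> x)"
  using assms unfolding bounded_op_def by blast+

lemma bounded_op_bound:
  assumes "bounded_op S T"
  obtains K where "K \<ge> 0" "\<And>\<psi>. \<psi> \<in> ell2 S \<Longrightarrow> l2norm S (T \<psi>) \<le> K * l2norm S \<psi>"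
proof -
  obtain K where K: "\<And>\<psi>. \<psi> \<in> ell2 S \<Longrightarrow> l2norm S (T \<psi>) \<le> K * l2norm S \<psi>"
    using assms unfolding bounded_op_def by blast
  \<comment> \<open>The constant in \<open>bounded_op_def\<close> has no prescribed sign, so its
    absolute value is taken.\<close>
  have "l2norm S (T \<psi>) \<le> \<bar>K\<bar> * l2norm S \<psi>" if "\<psi> \<in> ell2 S" for \<psi>
    using K[OF that] mult_right_mono[OF abs_ge_self[of K] l2norm_nonneg[of S \<psi>]] by linarith
  then show thesis
    using that[of "\<bar>K\<bar>"] by simp
qed

lemma bounded_op_diff:
  assumes "bounded_op S T" "\<phi> \<in> ell2 S" "\<psi> \<in> ell2 S"
  shows "T (\<lambda>x. \<phi> x - \<psi> x) = (\<lambda>x. T \<phi> x - T \<psi> x)"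
  using bounded_op_add[OF assms(1,2) ell2_scaleC[OF assms(3), of "-1"]]
    bounded_op_scaleC[OF assms(1,3), of "-1"]
  by (simp add: scaleC_minus_one)

lemma bounded_op_zero:
  assumes "bounded_op S T"
  shows "T (\<lambda>_. 0) = (\<lambda>_. 0)"
proof -
  have z: "(\<lambda>_. 0 :: 'b) \<in> ell2 S"
    by (simp add: ell2_def)
  show ?thesis
    using bounded_op_diff[OF assms z z] by simp
qed

lemma bounded_op_restr: "bounded_op S (restr B)"
proof -
  have "\<exists>K. \<forall>\<psi>\<in>ell2 S. l2norm S (restr B \<psi>) \<le> K * l2norm S (\<psi> :: 'a \<Rightarrow> 'b)"
    using l2norm_restr_le by (intro exI[of _ 1]) fastforce
  then show ?thesis
    unfolding bounded_op_def by (simp add: ell2_restr) (simp add: restr_def fun_eq_iff)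
qed

lemma bounded_op_comp:
  assumes "bounded_op S T" "bounded_op S U"
  shows "bounded_op S (T \<circ> U)"
proof -
  obtain K where K: "K \<ge> 0" "\<And>\<psi>. \<psi> \<in> ell2 S \<Longrightarrow> l2norm S (T \<psi>) \<le> K * l2norm S \<psi>"
    using bounded_op_bound[OF assms(1)] by blast
  obtain M where M: "M \<ge> 0" "\<And>\<psi>. \<psi> \<in> ell2 S \<Longrightarrow> l2norm S (U \<psi>) \<le> M * l2norm S \<psi>"
    using bounded_op_bound[OF assms(2)] by blast
  have "l2norm S (T (U \<psi>)) \<le> (K * M) * l2norm S \<psi>" if "\<psi> \<in> ell2 S" for \<psi>
    using K(2)[OF bounded_op_ell2[OF assms(2) that]] mult_left_mono[OF M(2)[OF that] K(1)]
    by (simp add: mult.assoc)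
  then have "\<exists>C. \<forall>\<psi>\<in>ell2 S. l2norm S ((T \<circ> U) \<psi>) \<le> C * l2norm S \<psi>"
    unfolding comp_def by blast
  then show ?thesis
    unfolding bounded_op_def
    using bounded_op_ell2[OF assms(1)] bounded_op_ell2[OF assms(2)]
      bounded_op_add[OF assms(1)] bounded_op_add[OF assms(2)]
      bounded_op_scaleC[OF assms(1)] bounded_op_scaleC[OF assms(2)]
    by (simp add: o_def)
qed

text \<open>Cutting to \<open>A\<close> first turns an operator on the subspace, such as the
  resolvent of a compression, into one on all of \<open>ell2 S\<close>, where
  \<open>op_norm S\<close> is taken.\<close>

lemma bounded_op_extend:
  assumes "bounded_op (S \<inter> A) T"
  shows "bounded_op S (T \<circ> restr A)"
proof -
  obtain K where K: "K \<ge> 0"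
    "\<And>\<psi>. \<psi> \<in> ell2 (S \<inter> A) \<Longrightarrow> l2norm (S \<inter> A) (T \<psi>) \<le> K * l2norm (S \<inter> A) \<psi>"
    using bounded_op_bound[OF assms] by blast
  have r: "restr A \<psi> \<in> ell2 (S \<inter> A)" if "\<psi> \<in> ell2 S" for \<psi> :: "'a \<Rightarrow> 'b"
    using ell2_restr_Int[OF that] .
  have e: "T (restr A \<psi>) \<in> ell2 (S \<inter> A)" if "\<psi> \<in> ell2 S" for \<psi>
    using bounded_op_ell2[OF assms r[OF that]] .
  have "l2norm S (T (restr A \<psi>)) \<le> K * l2norm S \<psi>" if "\<psi> \<in> ell2 S" for \<psi>
  proof -
    have "l2norm S (T (restr A \<psi>)) = l2norm (S \<inter> A) (T (restr A \<psi>))"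
      by (rule l2norm_supp[OF e[OF that]]) auto
    also have "\<dots> \<le> K * l2norm (S \<inter> A) (restr A \<psi>)"
      by (rule K(2)[OF r[OF that]])
    also have "l2norm (S \<inter> A) (restr A \<psi>) = l2norm S (restr A \<psi>)"
      by (simp add: l2norm_restr)
    also have "K * l2norm S (restr A \<psi>) \<le> K * l2norm S \<psi>"
      by (intro mult_left_mono l2norm_restr_le that K)
    finally show ?thesis .
  qed
  then have bd: "\<exists>C. \<forall>\<psi>\<in>ell2 S. l2norm S ((T \<circ> restr A) \<psi>) \<le> C * l2norm S \<psi>"
    unfolding comp_def by blast
  have radd: "restr A (\<lambda>x. \<phi> x + \<psi> x) = (\<lambda>x. restr A \<phi> x + restr A \<psi> x)" for \<phi> \<psi> :: "'a \<Rightarrow> 'b"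
    by (auto simp: restr_def)
  have rscale: "restr A (\<lambda>x. a *\<^sub>C \<psi> x) = (\<lambda>x. a *\<^sub>C restr A \<psi> x)" for a and \<psi> :: "'a \<Rightarrow> 'b"
    by (auto simp: restr_def)
  have "T (restr A \<psi>) \<in> ell2 S" if "\<psi> \<in> ell2 S" for \<psi>
    by (rule ell2_mono[OF e[OF that]]) auto
  then show ?thesis
    unfolding bounded_op_def
    using bd r bounded_op_add[OF assms] bounded_op_scaleC[OF assms]
    by (simp add: radd rscale)
qed

section \<open>The operator norm\<close>

text \<open>A real \<open>Sup\<close> dominates its set only if that set is bounded above; this is
  what makes \<open>op_norm\<close> an upper bound over the unit ball.\<close>

lemma op_norm_bdd_above:
  assumes "bounded_op S T"
  shows "bdd_above {l2norm S (T \<psi>) | \<psi>. \<psi> \<in> ell2 S \<and> l2norm S \<psi> \<le> 1}"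
proof -
  obtain K where K: "K \<ge> 0" "\<And>\<psi>. \<psi> \<in> ell2 S \<Longrightarrow> l2norm S (T \<psi>) \<le> K * l2norm S \<psi>"
    using bounded_op_bound[OF assms] by blast
  have "l2norm S (T \<phi>) \<le> K" if "\<phi> \<in> ell2 S" "l2norm S \<phi> \<le> 1" for \<phi>
    using K(2)[of \<phi>] mult_left_mono[of "l2norm S \<phi>" 1 K] K(1) that by simp
  then show ?thesis
    by (intro bdd_aboveI[of _ K]) auto
qed

lemma bounded_op_l2norm_le_op_norm:
  assumes T: "bounded_op S T" and \<psi>: "\<psi> \<in> ell2 S"
  shows "l2norm S (T \<psi>) \<le> op_norm S T * l2norm S \<psi>"
proof -
  obtain K where K: "K \<ge> 0" "\<And>\<psi>. \<psi> \<in> ell2 S \<Longrightarrow> l2norm S (T \<psi>) \<le> K * l2norm S \<psi>"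
    using bounded_op_bound[OF T] by blast
  show ?thesis
  \<comment> \<open>A function of norm zero cannot be normalised, but the bound \<open>K\<close>
    sends it to norm zero. All others are scaled to the unit sphere.\<close>
  proof (cases "l2norm S \<psi> = 0")
    case True
    then show ?thesis
      using K(2)[OF \<psi>] by simp
  next
    case False
    define c where "c = l2norm S \<psi>"
    have c: "c > 0"
      unfolding c_def using False l2norm_nonneg[of S \<psi>] by linarith
    let ?a = "complex_of_real (1 / c)"
    have "l2norm S (\<lambda>x. ?a *\<^sub>C \<psi> x) = 1"
      unfolding l2norm_scaleC using c by (simp add: c_def norm_divide)
    then have "l2norm S (T (\<lambda>x. ?a *\<^sub>C \<psi> x)) \<le> op_norm S T"
      unfolding op_norm_def using ell2_scaleC[OF \<psi>, of ?a] by (intro cSup_upper[OF _ op_norm_bdd_above[OF T]]) auto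
    moreover have "l2norm S (T (\<lambda>x. ?a *\<^sub>C \<psi> x)) = l2norm S (T \<psi>) / c"
      unfolding bounded_op_scaleC[OF T \<psi>] l2norm_scaleC using c by (simp add: norm_divide)
    ultimately show ?thesis
      using c by (simp add: field_simps c_def)
  qed
qed

lemma op_norm_nonneg:
  assumes "bounded_op S T"
  shows "0 \<le> op_norm S T"
proof -
  have "(\<lambda>_. 0 :: 'b) \<in> ell2 S" "l2norm S (\<lambda>_. 0 :: 'b) \<le> 1"
    by (simp_all add: ell2_def l2norm_def)
  then have "l2norm S (T (\<lambda>_. 0)) \<in> {l2norm S (T \<psi>) | \<psi>. \<psi> \<in> ell2 S \<and> l2norm S \<psi> \<le> 1}"
    by blast
  then have "l2norm S (T (\<lambda>_. 0)) \<le> op_norm S T"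
    unfolding op_norm_def by (rule cSup_upper[OF _ op_norm_bdd_above[OF assms]])
  with l2norm_nonneg show ?thesis
    by (rule order_trans)
qed

section \<open>Locality from matrix elements\<close>

text \<open>Matrix elements record only the action on single sites. Additivity extends the vanishing
  to finite truncations of \<open>\<psi>\<close>; boundedness of \<open>T\<close> and of point
  evaluation extends it to the limit.\<close>

lemma bounded_op_local:
  assumes T: "bounded_op S T" and \<psi>: "\<psi> \<in> ell2 S"
    and zero: "\<And>z. z \<in> S \<Longrightarrow> \<psi> z \<noteq> 0 \<Longrightarrow> matrix_element T y z = (\<lambda>v. 0)"
  shows "T \<psi> y = 0"
proof -
  obtain K where K: "K \<ge> 0" "\<And>\<psi>. \<psi> \<in> ell2 S \<Longrightarrow> l2norm S (T \<psi>) \<le> K * l2norm S \<psi>"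
    using bounded_op_bound[OF T] by blast
  have fin: "T (restr F \<psi>) y = 0" if "finite F" "F \<subseteq> S" for F
    using that
  proof (induction F rule: finite_induct)
    case empty
    have e: "restr {} \<psi> = (\<lambda>_. 0)"
      by (simp add: restr_def)
    show ?case
      unfolding e bounded_op_zero[OF T] ..
  next
    case (insert z F)
    \<comment> \<open>One site is peeled off: \<open>?s\<close> is the value \<open>\<psi> z\<close>
      placed at \<open>z\<close>. Where \<open>\<psi> z\<close> is zero the assumption says nothing,
      but then \<open>?s\<close> vanishes.\<close>
    let ?s = "\<lambda>x. if x = z then \<psi> z else 0"
    have s: "?s \<in> ell2 S"
      using insert by (intro ell2_single) auto
    have "T ?s y = 0"
    proof (cases "\<psi> z = 0")
      case True
      then have s0: "?s = (\<lambda>x. 0)"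
        by (simp add: fun_eq_iff)
      show ?thesis
        unfolding s0 bounded_op_zero[OF T] ..
    next
      case False
      then have "matrix_element T y z = (\<lambda>v. 0)"
        using zero insert by simp
      then show ?thesis
        unfolding matrix_element_def by metis
    qed
    moreover have "restr (insert z F) \<psi> = (\<lambda>x. ?s x + restr F \<psi> x)"
      using insert by (auto simp: restr_def)
    moreover have "T (restr F \<psi>) y = 0"
      using insert by simp
    ultimately show ?case
      by (simp only: bounded_op_add[OF T s ell2_restr[OF \<psi>]]) simp
  qed
  have small: "norm (T \<psi> y) \<le> e" if "e > 0" for e
  proof -
    \<comment> \<open>Dividing by \<open>K + 1\<close> is safe even for \<open>K = 0\<close>; after
      applying \<open>T\<close> the tail still costs at most \<open>e\<close>.\<close>
    obtain F where F: "finite F" "F \<subseteq> S" "l2norm S (restr (- F) \<psi>) \<le> e / (K + 1)"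
      using ell2_tail_small[OF \<psi>, of "e / (K + 1)"] \<open>e > 0\<close> K(1) by auto
    have split: "(\<lambda>x. restr F \<psi> x + restr (- F) \<psi> x) = \<psi>"
      by (auto simp: restr_def)
    have "T \<psi> y = T (restr F \<psi>) y + T (restr (- F) \<psi>) y"
      using bounded_op_add[OF T ell2_restr[OF \<psi>] ell2_restr[OF \<psi>], of F "- F"]
      unfolding split by (rule fun_cong)
    then have "norm (T \<psi> y) \<le> l2norm S (T (restr (- F) \<psi>))"
      using fin[OF F(1,2)] norm_le_l2norm[OF bounded_op_ell2[OF T ell2_restr[OF \<psi>]]] by simp
    also have "\<dots> \<le> K * (e / (K + 1))"
      using K(2)[OF ell2_restr[OF \<psi>]] mult_left_mono[OF F(3) K(1)] by (rule order_trans)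
    also have "\<dots> \<le> e"
      using K(1) \<open>e > 0\<close> by (simp add: field_simps)
    finally show ?thesis .
  qed
  have "norm (T \<psi> y) \<le> 0"
    by (rule field_le_epsilon, unfold add_0_left, rule small)
  then show ?thesis
    by simp
qed

section \<open>Resolvents off the spectrum\<close>

lemma ell2_shifted: "bounded_op S T \<Longrightarrow> \<psi> \<in> ell2 S \<Longrightarrow> shifted T z \<psi> \<in> ell2 S"
  unfolding shifted_def by (rule ell2_diff[OF bounded_op_ell2 ell2_scaleC])

text \<open>Off the spectrum \<open>shifted T z\<close> has a bounded two-sided inverse
  \<open>R\<close> on \<open>ell2 S\<close>. Injectivity removes the ambiguity of
  \<open>inv_into\<close>, so \<open>resolvent\<close> agrees with \<open>R\<close> there and
  inherits its boundedness.\<close>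

lemma
  assumes "z \<notin> op_spectrum S T"
  shows resolvent_shifted: "\<psi> \<in> ell2 S \<Longrightarrow> resolvent S T z (shifted T z \<psi>) = \<psi>"
    and bounded_op_resolvent: "bounded_op S (resolvent S T z)"
proof -
  obtain R where R: "bounded_op S R"
    and inv: "\<And>\<psi>. \<psi> \<in> ell2 S \<Longrightarrow> R (shifted T z \<psi>) = \<psi>"
      "\<And>\<psi>. \<psi> \<in> ell2 S \<Longrightarrow> shifted T z (R \<psi>) = \<psi>"
    using assms unfolding op_spectrum_def by blast
  have inj: "inj_on (shifted T z) (ell2 S)"
    by (rule inj_on_inverseI[of _ R]) (rule inv)
  then show "resolvent S T z (shifted T z \<psi>) = \<psi>" if "\<psi> \<in> ell2 S"
    unfolding resolvent_def using that by (rule inv_into_f_f)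
  have eq: "resolvent S T z \<psi> = R \<psi>" if "\<psi> \<in> ell2 S" for \<psi>
    unfolding resolvent_def
    by (rule inv_into_f_eq, rule inj, rule bounded_op_ell2[OF R that], rule inv(2)[OF that])
  then have bd: "\<exists>K. \<forall>\<psi>\<in>ell2 S. l2norm S (resolvent S T z \<psi>) \<le> K * l2norm S \<psi>"
    using R unfolding bounded_op_def by simp
  show "bounded_op S (resolvent S T z)"
    unfolding bounded_op_def using bd
    by (simp add: eq ell2_add ell2_scaleC bounded_op_ell2[OF R] bounded_op_add[OF R]
        bounded_op_scaleC[OF R])
qed

section \<open>Localized resolvents\<close>

text \<open>Geometric resolvent identity. By \<open>local\<close>, sites outside \<open>B\<close>
  contribute nothing to \<open>H \<psi>\<close> on \<open>A\<close>, so removing the coupling to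
  \<open>B - A\<close> leaves the shifted compression acting on \<open>restr A \<psi>\<close>, which
  the resolvent inverts. \<open>Q\<close> meets the lattice only inside \<open>A\<close>, so the
  final cut returns all of \<open>restr Q \<psi>\<close>.\<close>

lemma restr_resolvent_identity:
  assumes H: "bounded_op \<Gamma> H"
    and spec: "z \<notin> op_spectrum (\<Gamma> \<inter> A) (compression A H)"
    and A: "A \<subseteq> B" and Q: "Q \<inter> \<Gamma> \<subseteq> A"
    and local: "\<And>y u. y \<in> A \<Longrightarrow> u \<in> \<Gamma> - B \<Longrightarrow> matrix_element H y u = (\<lambda>v. 0)"
    and \<psi>: "\<psi> \<in> ell2 \<Gamma>"
  shows "restr Q \<psi> =
    (restr Q \<circ> resolvent (\<Gamma> \<inter> A) (compression A H) z \<circ> restr A)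
      (\<lambda>x. shifted H z \<psi> x - H (restr (B - A) \<psi>) x)"
proof -
  let ?E = "shifted (compression A H) z (restr A \<psi>)"
  have split: "H \<psi> y = H (restr A \<psi>) y + H (restr (B - A) \<psi>) y" if "y \<in> A" for y
  proof -
    \<comment> \<open>Since \<open>A \<subseteq> B\<close>, the three pieces are disjoint and
      exhaust the space.\<close>
    have sum: "(\<lambda>x. (restr A \<psi> x + restr (B - A) \<psi> x) + restr (- B) \<psi> x) = \<psi>"
      using A by (auto simp: restr_def fun_eq_iff)
    have "H \<psi> y = H (restr A \<psi>) y + H (restr (B - A) \<psi>) y + H (restr (- B) \<psi>) y"
      using bounded_op_add[OF H ell2_add[OF ell2_restr[OF \<psi>] ell2_restr[OF \<psi>]] ell2_restr[OF \<psi>],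
          of A "B - A" "- B"]
      unfolding sum bounded_op_add[OF H ell2_restr[OF \<psi>] ell2_restr[OF \<psi>]] by (rule fun_cong)
    moreover have "H (restr (- B) \<psi>) y = 0"
      by (rule bounded_op_local[OF H ell2_restr[OF \<psi>]])
        (use local that in \<open>auto simp: restr_def split: if_splits\<close>)
    ultimately show ?thesis
      by simp
  qed
  have E: "restr A (\<lambda>x. shifted H z \<psi> x - H (restr (B - A) \<psi>) x) = ?E"
  proof
    fix y
    \<comment> \<open>\<open>compression\<close> cuts to \<open>A\<close> once more; idempotence
      absorbs the second cut.\<close>
    have "restr A (restr A \<psi>) = restr A \<psi>"
      by (simp add: restr_def fun_eq_iff)
    then show "restr A (\<lambda>x. shifted H z \<psi> x - H (restr (B - A) \<psi>) x) y = ?E y"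
      using split[of y] by (simp add: shifted_def compression_def) (simp add: restr_def)
  qed
  have "resolvent (\<Gamma> \<inter> A) (compression A H) z ?E = restr A \<psi>"
    by (rule resolvent_shifted[OF spec ell2_restr_Int[OF \<psi>]])
  moreover have "restr Q (restr A \<psi>) = restr Q \<psi>"
    using Q ell2_off[OF \<psi>] by (auto simp: restr_def fun_eq_iff)
  ultimately show ?thesis
    by (simp add: E)
qed

lemma bounded_op_localized_resolvent:
  assumes "z \<notin> op_spectrum (\<Gamma> \<inter> A) T"
  shows "bounded_op \<Gamma> (restr Q \<circ> resolvent (\<Gamma> \<inter> A) T z \<circ> restr A)"
  using bounded_op_comp[OF bounded_op_restr bounded_op_extend[OF bounded_op_resolvent[OF assms]]]
  by (simp add: comp_assoc)

text \<open>The resolvent is tested on \<open>(H\<^sub>A - z)(\<delta>\<^sub>x \<otimes> v)\<close>.\<close>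

lemma op_norm_localized_resolvent_ge:
  fixes H :: "('i \<Rightarrow> 'h) \<Rightarrow> 'i \<Rightarrow> 'h::complex_inner"
  assumes H: "bounded_op \<Gamma> H" and K: "\<And>\<psi>. \<psi> \<in> ell2 \<Gamma> \<Longrightarrow> l2norm \<Gamma> (H \<psi>) \<le> K * l2norm \<Gamma> \<psi>"
    and spec: "z \<notin> op_spectrum (\<Gamma> \<inter> A) (compression A H)"
    and x: "x \<in> \<Gamma>" "x \<in> A" "x \<in> Q"
    and v: "(v::'h) \<noteq> 0"
  shows "1 \<le> op_norm \<Gamma> (restr Q \<circ> resolvent (\<Gamma> \<inter> A) (compression A H) z \<circ> restr A) * (K + cmod z)"
proof -
  let ?P = "restr Q \<circ> resolvent (\<Gamma> \<inter> A) (compression A H) z \<circ> restr A"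
  define e where "e = (\<lambda>y. if y = x then v else 0)"
  let ?f = "shifted (compression A H) z e"
  have e: "e \<in> ell2 \<Gamma>" "e \<in> ell2 (\<Gamma> \<inter> A)"
    unfolding e_def using x by (auto intro: ell2_single)
  have re: "restr A e = e" "restr Q e = e"
    using x by (auto simp: e_def restr_def)
  have He: "restr A (H e) \<in> ell2 \<Gamma>"
    by (rule ell2_restr[OF bounded_op_ell2[OF H e(1)]])
  have f_eq: "?f = (\<lambda>y. restr A (H e) y - z *\<^sub>C e y)"
    by (simp add: shifted_def compression_def re)
  have f: "?f \<in> ell2 \<Gamma>"
    unfolding f_eq by (rule ell2_diff[OF He ell2_scaleC[OF e(1)]])
  \<comment> \<open>Both terms of \<open>?f\<close> live on \<open>A\<close>: the first is cut to it
    and \<open>e\<close> sits at \<open>x\<close>. Hence the resolvent recovers \<open>e\<close>,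
    and the cut to \<open>Q\<close> keeps it.\<close>
  have "restr A ?f = ?f"
    unfolding f_eq using x by (auto simp: restr_def e_def fun_eq_iff)
  then have P: "?P ?f = e"
    using resolvent_shifted[OF spec e(2)] by (simp add: re)
  have "l2norm \<Gamma> ?f \<le> l2norm \<Gamma> (restr A (H e)) + cmod z * l2norm \<Gamma> e"
    unfolding f_eq using l2norm_diff[OF He ell2_scaleC[OF e(1)]] by (simp add: l2norm_scaleC)
  also have "\<dots> \<le> (K + cmod z) * l2norm \<Gamma> e"
    using l2norm_restr_le[OF bounded_op_ell2[OF H e(1)], of A] K[OF e(1)]
    by (simp add: distrib_right)
  finally have fn: "l2norm \<Gamma> ?f \<le> (K + cmod z) * l2norm \<Gamma> e" .
  note bP = bounded_op_localized_resolvent[OF spec, of Q]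
  have "l2norm \<Gamma> e \<le> op_norm \<Gamma> ?P * l2norm \<Gamma> ?f"
    using bounded_op_l2norm_le_op_norm[OF bP f] unfolding P .
  also have "\<dots> \<le> op_norm \<Gamma> ?P * ((K + cmod z) * l2norm \<Gamma> e)"
    by (rule mult_left_mono[OF fn op_norm_nonneg[OF bP]])
  finally have "1 * l2norm \<Gamma> e \<le> (op_norm \<Gamma> ?P * (K + cmod z)) * l2norm \<Gamma> e"
    by (simp add: mult.assoc)
  \<comment> \<open>Here \<open>v \<noteq> 0\<close> enters, so that the norm of \<open>e\<close>
    can be cancelled.\<close>
  moreover have "l2norm \<Gamma> e > 0"
    using norm_le_l2norm[OF e(1), of x] v by (simp add: e_def) (metis zero_less_norm_iff order_less_le_trans)
  ultimately show ?thesis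
    using mult_le_cancel_right_pos by blast
qed

text \<open>\<open>P\<close> begins by cutting to \<open>A\<close>, and the coupling term by cutting
  to \<open>B - A\<close>. Both see only data in \<open>B\<close>, which is why the norms on the
  right are local.\<close>

lemma l2norm_localized_le:
  assumes H: "bounded_op \<Gamma> H"
    and spec: "z \<notin> op_spectrum (\<Gamma> \<inter> A) (compression A H)"
    and A: "A \<subseteq> B" and Q: "Q \<inter> \<Gamma> \<subseteq> A"
    and local: "\<And>y u. y \<in> A \<Longrightarrow> u \<in> \<Gamma> - B \<Longrightarrow> matrix_element H y u = (\<lambda>v. 0)"
    and \<psi>: "\<psi> \<in> ell2 \<Gamma>"
    and P_def: "P = restr Q \<circ> resolvent (\<Gamma> \<inter> A) (compression A H) z \<circ> restr A"
  shows "l2norm (\<Gamma> \<inter> Q) \<psi> \<le> op_norm \<Gamma> P * l2norm (\<Gamma> \<inter> B) (shifted H z \<psi>)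
    + op_norm \<Gamma> (P \<circ> H \<circ> restr (B - A)) * l2norm (\<Gamma> \<inter> B) \<psi>"
proof -
  let ?f = "shifted H z \<psi>" and ?g = "H (restr (B - A) \<psi>)"
  have P: "bounded_op \<Gamma> P"
    unfolding P_def by (rule bounded_op_localized_resolvent[OF spec])
  have f: "?f \<in> ell2 \<Gamma>" and g: "?g \<in> ell2 \<Gamma>"
    by (rule ell2_shifted[OF H \<psi>], rule bounded_op_ell2[OF H ell2_restr[OF \<psi>]])
  have BB: "restr (B - A) (restr B \<psi>) = restr (B - A) \<psi>"
    by (auto simp: restr_def fun_eq_iff)
  have PB: "P ?f = P (restr B ?f)"
  proof -
    have "restr A (restr B ?f) = restr A ?f"
      using A by (auto simp: restr_def fun_eq_iff)
    then show ?thesis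
      by (simp add: P_def)
  qed
  have "restr Q \<psi> = P (\<lambda>x. ?f x - ?g x)"
    unfolding P_def by (rule restr_resolvent_identity[OF H spec A Q local \<psi>])
  also have "\<dots> = (\<lambda>x. P ?f x - P ?g x)"
    by (rule bounded_op_diff[OF P f g])
  finally have "l2norm (\<Gamma> \<inter> Q) \<psi> \<le> l2norm \<Gamma> (P (restr B ?f)) + l2norm \<Gamma> ((P \<circ> H \<circ> restr (B - A)) (restr B \<psi>))"
    using l2norm_diff[OF bounded_op_ell2[OF P f] bounded_op_ell2[OF P g]]
    by (simp flip: l2norm_restr add: PB BB)
  also have "\<dots> \<le> op_norm \<Gamma> P * l2norm \<Gamma> (restr B ?f)
      + op_norm \<Gamma> (P \<circ> H \<circ> restr (B - A)) * l2norm \<Gamma> (restr B \<psi>)"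
    by (intro add_mono bounded_op_l2norm_le_op_norm bounded_op_comp bounded_op_restr P H
        ell2_restr f \<psi>)
  finally show ?thesis
    by (simp add: l2norm_restr)
qed

section \<open>Geometry of cubes\<close>

lemma cube_mono:
  assumes "\<rho> \<le> \<sigma>"
  shows "cube \<rho> x \<subseteq> cube \<sigma> x"
proof
  fix y assume y: "y \<in> cube \<rho> x"
  have "x $ j - \<sigma> < y $ j \<and> y $ j < x $ j + \<sigma>" for j
  proof -
    have "x $ j - \<rho> < y $ j \<and> y $ j < x $ j + \<rho>"
      using y by (simp add: cube_def)
    then show ?thesis
      using assms by linarith
  qed
  then show "y \<in> cube \<sigma> x"
    by (simp add: cube_def)
qed

text \<open>In a coordinate where \<open>u\<close> leaves the large cube, \<open>y\<close> lies
  strictly more than \<open>m\<close> inside it. Openness of the small cube gives the strict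
  inequality that \<open>finite_range\<close> asks for.\<close>

lemma infnorm_gt_of_cubes:
  fixes x y u :: "real^'d"
  assumes "y \<in> cube (L - m) x" "u \<notin> cube L x"
  shows "infnorm (y - u) > m"
proof -
  obtain j where j: "u $ j \<le> x $ j - L \<or> x $ j + L \<le> u $ j"
    using assms(2) by (auto simp: cube_def not_less)
  have "x $ j - (L - m) < y $ j \<and> y $ j < x $ j + (L - m)"
    using assms(1) by (auto simp: cube_def)
  with j have "m < \<bar>(y - u) $ j\<bar>"
    by auto
  also have "\<dots> \<le> infnorm (y - u)"
    by (rule component_le_infnorm_cart)
  finally show ?thesis .
qed

section \<open>A contraction factor uniform in the centre\<close>

theorem proposition1:
  fixes \<Gamma> :: "(real^'d) set"
    and H :: "(real^'d \<Rightarrow> 'h) \<Rightarrow> (real^'d \<Rightarrow> 'h::complex_hilbert)"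
    and r m L l lam \<epsilon> :: real
    and N :: nat
    and A :: "real^'d \<Rightarrow> (real^'d) set"
    and D G :: "real^'d \<Rightarrow> real"
  assumes countable: "countable \<Gamma>"
    and r_pos: "r > 0"
    and covering: "\<forall>y. \<exists>x\<in>\<Gamma>. infnorm (y - x) \<le> r"
    and nontrivial: "\<exists>v::'h. v \<noteq> 0"
    and separable: "separable_space (euclidean :: 'h topology)"
    and bounded: "bounded_op \<Gamma> H"
    and selfadjoint: "selfadjoint_op \<Gamma> H"
    and m_nonneg: "m \<ge> 0"
    and range: "finite_range \<Gamma> m H"
    and L_pos: "L > 0"
    and N_ge_2: "N \<ge> 2"
    and l_def: "l = (L + r) / real N + r"
    and A_subset: "\<forall>x\<in>\<Gamma>. A x \<subseteq> \<Gamma>"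
    and A_lower: "\<forall>x\<in>\<Gamma>. closure (cube l x) \<inter> \<Gamma> \<subseteq> A x"
    and A_upper: "\<forall>x\<in>\<Gamma>. A x \<subseteq> cube (L - m) x"
    and A_resolvent: "\<forall>x\<in>\<Gamma>. complex_of_real lam \<notin> op_spectrum (\<Gamma> \<inter> A x) (compression (A x) H)"
    and D_def: "\<forall>x\<in>\<Gamma>. D x = op_norm \<Gamma>
          (restr (closure (cube l x)) \<circ>
           resolvent (\<Gamma> \<inter> A x) (compression (A x) H) (complex_of_real lam) \<circ>
           restr (A x) \<circ> H \<circ> restr (cube L x - A x))"
    and G_def: "\<forall>x\<in>\<Gamma>. G x = op_norm \<Gamma>
          (restr (closure (cube l x)) \<circ>
           resolvent (\<Gamma> \<inter> A x) (compression (A x) H) (complex_of_real lam) \<circ>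
           restr (A x))"
    and D_less: "\<forall>x\<in>\<Gamma>. D x < real N powr (- real CARD('d) / 2)"
    and \<epsilon>_pos: "\<epsilon> > 0"
    and \<epsilon>_less: "\<epsilon> < (INF x\<in>\<Gamma>. (real N powr (- real CARD('d) / 2) - D x) / G x)"
  shows "bulk_gapped \<Gamma> r H \<epsilon> lam L"
proof -
  \<comment> \<open>\<open>q\<close> squares to \<open>1 / real N ^ CARD('d)\<close>, and
    \<open>\<delta>\<close> is the infimum that bounds \<open>\<epsilon>\<close>.\<close>
  define q where "q = real N powr (- real CARD('d) / 2)"
  define \<delta> where "\<delta> = (INF x\<in>\<Gamma>. (q - D x) / G x)"
  obtain K where K: "K \<ge> 0" "\<And>\<psi>. \<psi> \<in> ell2 \<Gamma> \<Longrightarrow> l2norm \<Gamma> (H \<psi>) \<le> K * l2norm \<Gamma> \<psi>"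
    using bounded_op_bound[OF bounded] by blast
  obtain v :: 'h where v: "v \<noteq> 0"
    using nontrivial by blast
  \<comment> \<open>\<open>K + \<bar>lam\<bar>\<close> bounds the norm of \<open>H - lam\<close>;
    the extra 1 keeps \<open>M\<close> positive when both vanish.\<close>
  define M where "M = K + \<bar>lam\<bar> + 1"
  have M: "M > 0"
    using K(1) by (simp add: M_def)
  define P where "P x = restr (closure (cube l x)) \<circ>
    resolvent (\<Gamma> \<inter> A x) (compression (A x) H) (complex_of_real lam) \<circ> restr (A x)" for x
  have l_pos: "l > 0"
    using l_def r_pos L_pos by (simp add: add_nonneg_pos)
  have P: "bounded_op \<Gamma> (P x)" if "x \<in> \<Gamma>" for x
    unfolding P_def by (rule bounded_op_localized_resolvent) (use A_resolvent that in blast)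
  have G: "G x = op_norm \<Gamma> (P x)" and D: "D x = op_norm \<Gamma> (P x \<circ> H \<circ> restr (cube L x - A x))"
    if "x \<in> \<Gamma>" for x
    using G_def D_def that by (simp_all add: P_def)
  have D_nonneg: "D x \<ge> 0" and G_ge: "G x * M \<ge> 1" and G_pos: "G x > 0" if "x \<in> \<Gamma>" for x
  proof -
    \<comment> \<open>As \<open>l > 0\<close>, the centre lies in its own closed cube and hence in
      \<open>A x\<close>, so a vector at that site tests the resolvent from below.\<close>
    have "x \<in> closure (cube l x)"
      using l_pos by (intro closure_subset[THEN subsetD]) (simp add: cube_def)
    then have "1 \<le> G x * (K + cmod (complex_of_real lam))"
      unfolding G[OF that] P_def
      using A_resolvent A_lower that v
      by (intro op_norm_localized_resolvent_ge[OF bounded K(2)]) auto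
    moreover have G0: "G x \<ge> 0"
      unfolding G[OF that] by (rule op_norm_nonneg[OF P[OF that]])
    ultimately show "G x * M \<ge> 1"
      by (simp add: M_def distrib_left)
    with G0 show "G x > 0"
      by (cases "G x = 0") auto
    show "D x \<ge> 0"
      unfolding D[OF that]
      by (intro op_norm_nonneg bounded_op_comp bounded_op_restr P that bounded)
  qed
  have gap: "G x * \<delta> \<le> q - D x" if "x \<in> \<Gamma>" for x
  proof -
    \<comment> \<open>The quotients are positive, so the real infimum is a genuine lower
      bound.\<close>
    have "bdd_below ((\<lambda>x. (q - D x) / G x) ` \<Gamma>)"
      using D_less G_pos by (intro bdd_belowI2[of _ 0]) (simp add: q_def order_less_imp_le)
    then have "\<delta> \<le> (q - D x) / G x"
      unfolding \<delta>_def using that by (rule cINF_lower)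
    then show ?thesis
      using G_pos[OF that] by (simp add: field_simps)
  qed
  \<comment> \<open>A single \<open>C\<close> must serve all centres, so a strict bound at each
    \<open>x\<close> is not enough. Since \<open>G x\<close> is at least \<open>1 / M\<close>, the
    slack \<open>G x * (\<delta> - \<epsilon>)\<close> never falls below
    \<open>\<kappa>\<close>.\<close>
  define \<kappa> where "\<kappa> = (\<delta> - \<epsilon>) / M"
  have \<delta>\<epsilon>: "\<delta> > \<epsilon>"
    using \<epsilon>_less by (simp add: \<delta>_def q_def)
  then have \<kappa>: "\<kappa> > 0"
    using M by (simp add: \<kappa>_def)
  have key: "G x * \<epsilon> + D x \<le> q - \<kappa>" if "x \<in> \<Gamma>" for x
  proof -
    have "1 / M \<le> G x"
      using G_ge[OF that] M by (simp add: field_simps)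
    then have "\<kappa> \<le> G x * (\<delta> - \<epsilon>)"
      using mult_right_mono[of "1 / M" "G x" "\<delta> - \<epsilon>"] \<delta>\<epsilon> by (simp add: \<kappa>_def)
    then show ?thesis
      using gap[OF that] by (simp add: right_diff_distrib)
  qed
  \<comment> \<open>Squaring keeps \<open>q - \<kappa> < q\<close> strict once the left side is
    nonnegative. The covering supplies a centre, and \<open>key\<close> at that centre gives the
    sign.\<close>
  have q\<kappa>: "0 \<le> q - \<kappa>"
  proof -
    obtain x where x: "x \<in> \<Gamma>"
      using covering by blast
    have "0 \<le> G x * \<epsilon> + D x"
      using G_pos[OF x] D_nonneg[OF x] \<epsilon>_pos by simp
    then show ?thesis
      using key[OF x] by linarith
  qed
  have "q\<^sup>2 = real N powr (- real CARD('d))"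
    by (simp add: q_def power2_eq_square flip: powr_add)
  also have "\<dots> = 1 / real N ^ CARD('d)"
    using N_ge_2 by (simp add: powr_minus powr_realpow divide_inverse)
  finally have "(q - \<kappa>)\<^sup>2 < 1 / real N ^ CARD('d)"
    using power_strict_mono[of "q - \<kappa>" q 2] q\<kappa> \<kappa> by simp
  moreover have "(l2norm (\<Gamma> \<inter> closure (cube l x)) \<psi>)\<^sup>2 \<le> (q - \<kappa>)\<^sup>2 * (l2norm (\<Gamma> \<inter> cube L x) \<psi>)\<^sup>2"
    if x: "x \<in> \<Gamma>" and \<psi>: "\<psi> \<in> ell2 \<Gamma>"
      and small: "l2norm (\<Gamma> \<inter> cube L x) (shifted H (complex_of_real lam) \<psi>)
        \<le> \<epsilon> * l2norm (\<Gamma> \<inter> cube L x) \<psi>" for x \<psi>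
  proof -
    have A_sub: "A x \<subseteq> cube L x"
      using A_upper x m_nonneg cube_mono[of "L - m" L x] by fastforce
    have local: "matrix_element H y u = (\<lambda>v. 0)" if "y \<in> A x" "u \<in> \<Gamma> - cube L x" for y u
    proof -
      have "infnorm (y - u) > m"
        using A_upper x that by (intro infnorm_gt_of_cubes[of y L m x u]) auto
      then show ?thesis
        using range A_subset x that unfolding finite_range_def by blast
    qed
    \<comment> \<open>The localized estimate is used with the closed small cube as \<open>Q\<close>
      and the large cube as \<open>B\<close>; \<open>small\<close> and \<open>key\<close> then merge
      both terms into the factor \<open>q - \<kappa>\<close>.\<close>
    have "l2norm (\<Gamma> \<inter> closure (cube l x)) \<psi>
        \<le> G x * l2norm (\<Gamma> \<inter> cube L x) (shifted H (complex_of_real lam) \<psi>)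
          + D x * l2norm (\<Gamma> \<inter> cube L x) \<psi>"
      unfolding G[OF x] D[OF x]
      by (rule l2norm_localized_le[OF bounded _ A_sub _ local \<psi> P_def])
        (use A_resolvent A_lower x in auto)
    also have "\<dots> \<le> G x * (\<epsilon> * l2norm (\<Gamma> \<inter> cube L x) \<psi>) + D x * l2norm (\<Gamma> \<inter> cube L x) \<psi>"
      using mult_left_mono[OF small, of "G x"] G_pos[OF x] by simp
    also have "\<dots> = (G x * \<epsilon> + D x) * l2norm (\<Gamma> \<inter> cube L x) \<psi>"
      by (simp add: distrib_right)
    also have "\<dots> \<le> (q - \<kappa>) * l2norm (\<Gamma> \<inter> cube L x) \<psi>"
      by (rule mult_right_mono[OF key[OF x] l2norm_nonneg])
    finally show ?thesis
      using power_mono[of _ _ 2] by (fastforce simp: power_mult_distrib)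
  qed
  \<comment> \<open>The given \<open>N\<close> reproduces the same \<open>l\<close>, and
    \<open>(q - \<kappa>)\<^sup>2\<close> serves as \<open>C\<close>.\<close>
  ultimately show ?thesis
    unfolding bulk_gapped_def Let_def l_def[symmetric] using N_ge_2
    by (intro exI[of _ N] exI[of _ "(q - \<kappa>)\<^sup>2"]) (auto simp flip: l_def)
qed

end
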